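(* Let $X$ be a locally compact Hausdorff space and let $\lambda$ be a signed topological measure on $X$. (I) The positive variation $\lambda^{+}$ is the unique smallest deficient topological measure $\nu$ on $X$ such that $\nu\ge\lambda$ on $\mathcal{O}(X)\cup\mathcal{C}(X)$, and the negative variation $\lambda^{-}$ is the unique smallest deficient topological measure $\nu$ on $X$ such that $-\nu\le\lambda$ on $\mathcal{O}(X)\cup\mathcal{C}(X)$ (that is, $-\lambda^{-}$ is the largest among the set functions $-\nu\le\lambda$ with $\nu$ a deficient topological measure). Also, $|\lambda|=\lambda^{+}+\lambda^{-}$. (II) If at least one of $\lambda^{+},\lambda^{-}$ is finite (in particular, if $\|\lambda\|<\infty$), then also $\lambda=\lambda^{+}-\lambda^{-}$.
   Context: $\mathcal{O}(X), \mathcal{C}(X), \mathcal{K}(X)$ denote the families of open, closed, compact subsets of $X$. Set functions into the extended reals are assumed not to be identically $\infty$ or identically $-\infty$. A signed topological measure on $X$ is a set function $\lambda:\mathcal{O}(X)\cup\mathcal{C}(X)\to[-\infty,\infty]$ that assumes at most one of $\infty,-\infty$ and satisfies: (1) if $A,B,A\sqcup B\in\mathcal{K}(X)\cup\mathcal{O}(X)$ ($A,B$ disjoint) then $\lambda(A\sqcup B)=\lambda(A)+\lambda(B)$; (2) for $U$ open, $\lambda(U)$ is the limit of the net $\lambda(K)$ over compact $K\subseteq U$ ordered by inclusion; (3) for $F$ closed, $\lambda(F)$ is the limit of the net $\lambda(U)$ over open $U\supseteq F$ ordered by reverse inclusion. A deficient topological measure on $X$ is a set function $\nu:\mathcal{C}(X)\cup\mathcal{O}(X)\to[0,\infty]$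 such that $\nu(C\sqcup K)=\nu(C)+\nu(K)$ for disjoint compact $C,K$; $\nu(U)=\sup\{\nu(C):C\subseteq U,C\in\mathcal{K}(X)\}$ for $U$ open; $\nu(F)=\inf\{\nu(U):F\subseteq U,U\in\mathcal{O}(X)\}$ for $F$ closed. It is finite if $\nu(X)<\infty$. For $U$ open: $\lambda^{+}(U)=\sup\{\lambda(K):K\subseteq U,K\in\mathcal{K}(X)\}$ and $|\lambda|(U)=\sup\{\sum_{i=1}^n|\lambda(K_i)|:\bigsqcup_{i=1}^nK_i\subseteq U,\ K_i\in\mathcal{K}(X),\ n\in\mathbb{N}\}$ (the $K_i$ pairwise disjoint). For $F$ closed: $\lambda^{+}(F)=\inf\{\lambda^{+}(U):F\subseteq U,U\in\mathcal{O}(X)\}$ and $|\lambda|(F)=\inf\{|\lambda|(U):F\subseteq U,U\in\mathcal{O}(X)\}$. $\lambda^{-}=(-\lambda)^{+}$. $\|\lambda\|=\sup\{|\lambda(K)|:K\in\mathcal{K}(X)\}$. *)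

theory Defs
  imports "HOL-Analysis.Analysis"
begin

text \<open>
  A set function on the open and closed subsets of \<open>X\<close> is represented by a total function
  \<open>'a set \<Rightarrow> ereal\<close>; only its values on \<open>oc_sets X\<close> are meaningful. Accordingly, all order
  relations and equalities between set functions are stated on \<open>oc_sets X\<close> only.
\<close>

definition oc_sets :: "'a topology \<Rightarrow> 'a set set" where
  "oc_sets X = {A. openin X A \<or> closedin X A}"

definition ko_sets :: "'a topology \<Rightarrow> 'a set set" where
  "ko_sets X = {A. compactin X A \<or> openin X A}"

text \<open>
  The filters of tails of the two nets: the compact subsets of \<open>U\<close> directed by inclusion, and
  the open supersets of \<open>F\<close> directed by reverse inclusion (compare \<^const>\<open>finite_subsets_at_top\<close>).
\<close>

definition compact_subsets_at :: "'a topology \<Rightarrow> 'a set \<Rightarrow> 'a set filter" where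
  "compact_subsets_at X U =
     (INF K\<in>{K. compactin X K \<and> K \<subseteq> U}. principal {L. compactin X L \<and> K \<subseteq> L \<and> L \<subseteq> U})"

definition open_supersets_at :: "'a topology \<Rightarrow> 'a set \<Rightarrow> 'a set filter" where
  "open_supersets_at X F =
     (INF U\<in>{U. openin X U \<and> F \<subseteq> U}. principal {V. openin X V \<and> F \<subseteq> V \<and> V \<subseteq> U})"

definition signed_topological_measure :: "'a topology \<Rightarrow> ('a set \<Rightarrow> ereal) \<Rightarrow> bool" where
  "signed_topological_measure X \<mu> \<longleftrightarrow>
     \<not> (\<forall>A\<in>oc_sets X. \<mu> A = \<infinity>) \<and>
     \<not> (\<forall>A\<in>oc_sets X. \<mu> A = -\<infinity>) \<and>
     \<not> ((\<exists>A\<in>oc_sets X. \<mu> A = \<infinity>) \<and> (\<exists>A\<in>oc_sets X. \<mu> A = -\<infinity>)) \<and>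
     (\<forall>A B. A \<in> ko_sets X \<and> B \<in> ko_sets X \<and> A \<union> B \<in> ko_sets X \<and> A \<inter> B = {} \<longrightarrow>
        \<mu> (A \<union> B) = \<mu> A + \<mu> B) \<and>
     (\<forall>U. openin X U \<longrightarrow> (\<mu> \<longlongrightarrow> \<mu> U) (compact_subsets_at X U)) \<and>
     (\<forall>F. closedin X F \<longrightarrow> (\<mu> \<longlongrightarrow> \<mu> F) (open_supersets_at X F))"

definition deficient_topological_measure :: "'a topology \<Rightarrow> ('a set \<Rightarrow> ereal) \<Rightarrow> bool" where
  "deficient_topological_measure X \<nu> \<longleftrightarrow>
     \<not> (\<forall>A\<in>oc_sets X. \<nu> A = \<infinity>) \<and>
     (\<forall>A\<in>oc_sets X. 0 \<le> \<nu> A) \<and>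
     (\<forall>C K. compactin X C \<and> compactin X K \<and> C \<inter> K = {} \<longrightarrow> \<nu> (C \<union> K) = \<nu> C + \<nu> K) \<and>
     (\<forall>U. openin X U \<longrightarrow> \<nu> U = (SUP C\<in>{C. compactin X C \<and> C \<subseteq> U}. \<nu> C)) \<and>
     (\<forall>F. closedin X F \<longrightarrow> \<nu> F = (INF U\<in>{U. openin X U \<and> F \<subseteq> U}. \<nu> U))"

definition finite_set_function :: "'a topology \<Rightarrow> ('a set \<Rightarrow> ereal) \<Rightarrow> bool" where
  "finite_set_function X \<nu> \<longleftrightarrow> \<nu> (topspace X) < \<infinity>"

definition pos_var_open :: "'a topology \<Rightarrow> ('a set \<Rightarrow> ereal) \<Rightarrow> 'a set \<Rightarrow> ereal" where
  "pos_var_open X \<mu> U = (SUP K\<in>{K. compactin X K \<and> K \<subseteq> U}. \<mu> K)"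

definition total_var_open :: "'a topology \<Rightarrow> ('a set \<Rightarrow> ereal) \<Rightarrow> 'a set \<Rightarrow> ereal" where
  "total_var_open X \<mu> U =
     Sup {(\<Sum>i<n. \<bar>\<mu> (K i)\<bar>) | (n::nat) K.
            (\<forall>i<n. compactin X (K i)) \<and> disjoint_family_on K {..<n} \<and> (\<Union>i<n. K i) \<subseteq> U}"

text \<open>
  On sets that are both open and closed the two clauses below agree, because the functions
  \<open>pos_var_open\<close> and \<open>total_var_open\<close> are monotone; see the lemmas on closed sets.
\<close>

definition pos_var :: "'a topology \<Rightarrow> ('a set \<Rightarrow> ereal) \<Rightarrow> 'a set \<Rightarrow> ereal" where
  "pos_var X \<mu> A =
     (if openin X A then pos_var_open X \<mu> A
      else (INF U\<in>{U. openin X U \<and> A \<subseteq> U}. pos_var_open X \<mu> U))"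

definition neg_var :: "'a topology \<Rightarrow> ('a set \<Rightarrow> ereal) \<Rightarrow> 'a set \<Rightarrow> ereal" where
  "neg_var X \<mu> = pos_var X (\<lambda>A. - \<mu> A)"

definition total_var :: "'a topology \<Rightarrow> ('a set \<Rightarrow> ereal) \<Rightarrow> 'a set \<Rightarrow> ereal" where
  "total_var X \<mu> A =
     (if openin X A then total_var_open X \<mu> A
      else (INF U\<in>{U. openin X U \<and> A \<subseteq> U}. total_var_open X \<mu> U))"

definition stm_norm :: "'a topology \<Rightarrow> ('a set \<Rightarrow> ereal) \<Rightarrow> ereal" where
  "stm_norm X \<mu> = (SUP K\<in>{K. compactin X K}. \<bar>\<mu> K\<bar>)"

lemma pos_var_open_mono: "U \<subseteq> V \<Longrightarrow> pos_var_open X \<mu> U \<le> pos_var_open X \<mu> V"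
  unfolding pos_var_open_def by (rule SUP_subset_mono) auto

lemma total_var_open_mono: "U \<subseteq> V \<Longrightarrow> total_var_open X \<mu> U \<le> total_var_open X \<mu> V"
  unfolding total_var_open_def by (rule Sup_subset_mono) blast

lemma pos_var_closed:
  "closedin X F \<Longrightarrow> pos_var X \<mu> F = (INF U\<in>{U. openin X U \<and> F \<subseteq> U}. pos_var X \<mu> U)"
  by (cases "openin X F")
    (auto simp: pos_var_def intro!: antisym INF_greatest INF_lower pos_var_open_mono)

lemma total_var_closed:
  "closedin X F \<Longrightarrow> total_var X \<mu> F = (INF U\<in>{U. openin X U \<and> F \<subseteq> U}. total_var X \<mu> U)"
  by (cases "openin X F")
    (auto simp: total_var_def intro!: antisym INF_greatest INF_lower total_var_open_mono)

definition smallest_on :: "'a set set \<Rightarrow> ('a set \<Rightarrow> ereal) set \<Rightarrow> ('a set \<Rightarrow> ereal) \<Rightarrow> bool" where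
  "smallest_on D S f \<longleftrightarrow> f \<in> S \<and> (\<forall>g\<in>S. \<forall>A\<in>D. f A \<le> g A)"

definition largest_on :: "'a set set \<Rightarrow> ('a set \<Rightarrow> ereal) set \<Rightarrow> ('a set \<Rightarrow> ereal) \<Rightarrow> bool" where
  "largest_on D S f \<longleftrightarrow> f \<in> S \<and> (\<forall>g\<in>S. \<forall>A\<in>D. g A \<le> f A)"

definition unique_smallest_on ::
    "'a set set \<Rightarrow> ('a set \<Rightarrow> ereal) set \<Rightarrow> ('a set \<Rightarrow> ereal) \<Rightarrow> bool" where
  "unique_smallest_on D S f \<longleftrightarrow>
     smallest_on D S f \<and> (\<forall>g. smallest_on D S g \<longrightarrow> (\<forall>A\<in>D. g A = f A))"

end

theory Submission
  imports Defs
begin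

text \<open>
  Write \<open>\<mu>\<^sup>+\<close> and \<open>\<mu>\<^sup>-\<close> for the two variations. That \<open>\<mu>\<^sup>+\<close> is the smallest deficient topological
  measure above \<open>\<mu>\<close> is almost built into its definition: any competitor \<open>\<nu> \<ge> \<mu>\<close> is determined
  on open sets by its values on compact sets, where it dominates \<open>\<mu>\<close>, so it dominates the supremum
  defining \<open>\<mu>\<^sup>+\<close>; closed sets follow by taking infima. The point that needs work is that \<open>\<mu>\<^sup>+\<close> is
  additive on disjoint compact sets. It is additive on disjoint open sets \<open>U\<close>, \<open>V\<close>, because the
  compact subsets of \<open>U \<union> V\<close> are exactly the unions of a compact subset of \<open>U\<close> and one of \<open>V\<close>
  (\<open>pos_var_additive_open\<close>), and disjoint compact sets in a Hausdorff space have disjoint open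
  neighbourhoods (\<open>pos_var_additive_compact\<close>). Since \<open>-\<mu>\<close> is again a signed topological measure,
  everything proved for \<open>\<mu>\<^sup>+\<close> transfers to \<open>\<mu>\<^sup>-\<close>.

  The remaining identities rest on splitting an open set \<open>U\<close> along a compact \<open>C \<subseteq> U\<close>:
  \<open>\<mu> U = \<mu> C + \<mu> (U - C)\<close>, where \<open>U - C\<close> is open. Hence
  \<open>\<mu> C = \<mu> U - \<mu> (U - C) \<le> \<mu> U + \<mu>\<^sup>- U\<close>, and the supremum over \<open>C\<close> gives
  \<open>\<mu>\<^sup>+ U \<le> \<mu> U + \<mu>\<^sup>- U\<close> (\<open>pos_var_open_le_add_neg_var\<close>). The same inequality for \<open>-\<mu>\<close> is the
  reverse one, so \<open>\<mu> U = \<mu>\<^sup>+ U - \<mu>\<^sup>- U\<close> as soon as one of the variations is finite at \<open>U\<close>.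

  For the total variation, \<open>\<bar>\<mu>\<bar> \<le> \<mu>\<^sup>+ + \<mu>\<^sup>-\<close> follows by collecting the sets of a disjoint compact
  family according to the sign of \<open>\<mu>\<close>. Conversely, near-optimal sets for \<open>\<mu>\<^sup>+ U\<close> and
  \<open>\<mu>\<^sup>- U\<close> may overlap, so they cannot simply be combined. Instead, pairing a compact \<open>K \<subseteq> U\<close> with compact
  subsets of \<open>U - K\<close> yields \<open>\<mu> K - \<mu> (U - K) \<le> \<bar>\<mu>\<bar> U\<close>, that is \<open>2 \<mu> K - \<mu> U \<le> \<bar>\<mu>\<bar> U\<close>. The
  supremum over \<open>K\<close> turns the left-hand side into \<open>2 \<mu>\<^sup>+ U - \<mu> U\<close>, which is \<open>\<mu>\<^sup>+ U + \<mu>\<^sup>- U\<close> by the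
  decomposition (\<open>pos_add_neg_le_total_var_open\<close>). This needs finite values; if \<open>\<mu>\<^sup>+ U\<close> or
  \<open>\<mu>\<^sup>- U\<close> is infinite, so is \<open>\<bar>\<mu>\<bar> U\<close>, which dominates both.

  All identities are proved on open sets and carried over to a closed set along the net of its
  open supersets.
\<close>

section \<open>The nets of compact subsets and open supersets\<close>

text \<open>
  The compact subsets of \<open>U\<close> are directed by finite unions, so the defining infimum of principal
  filters is reached by single tails of the net.
\<close>

lemma eventually_compact_subsets_at:
  "eventually P (compact_subsets_at X U) \<longleftrightarrow>
     (\<exists>K. compactin X K \<and> K \<subseteq> U \<and> (\<forall>L. compactin X L \<and> K \<subseteq> L \<and> L \<subseteq> U \<longrightarrow> P L))"
  unfolding compact_subsets_at_def
proof (subst eventually_INF_base)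
  show "{K. compactin X K \<and> K \<subseteq> U} \<noteq> {}"
    using compactin_empty by blast
next
  fix K L assume "K \<in> {K. compactin X K \<and> K \<subseteq> U}" "L \<in> {K. compactin X K \<and> K \<subseteq> U}"
  then have "K \<union> L \<in> {K. compactin X K \<and> K \<subseteq> U}"
    by (simp add: compactin_Un)
  then show "\<exists>M\<in>{K. compactin X K \<and> K \<subseteq> U}.
      principal {N. compactin X N \<and> M \<subseteq> N \<and> N \<subseteq> U} \<le>
      inf (principal {N. compactin X N \<and> K \<subseteq> N \<and> N \<subseteq> U})
          (principal {N. compactin X N \<and> L \<subseteq> N \<and> N \<subseteq> U})"
    by (rule rev_bexI) auto
qed (auto simp: eventually_principal)

lemma eventually_open_supersets_at:
  assumes "F \<subseteq> topspace X"
  shows "eventually P (open_supersets_at X F) \<longleftrightarrow>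
     (\<exists>U. openin X U \<and> F \<subseteq> U \<and> (\<forall>V. openin X V \<and> F \<subseteq> V \<and> V \<subseteq> U \<longrightarrow> P V))"
  unfolding open_supersets_at_def
proof (subst eventually_INF_base)
  show "{U. openin X U \<and> F \<subseteq> U} \<noteq> {}"
    using assms by blast
next
  fix U V assume "U \<in> {U. openin X U \<and> F \<subseteq> U}" "V \<in> {U. openin X U \<and> F \<subseteq> U}"
  then have "U \<inter> V \<in> {U. openin X U \<and> F \<subseteq> U}"
    by (simp add: openin_Int)
  then show "\<exists>W\<in>{U. openin X U \<and> F \<subseteq> U}.
      principal {N. openin X N \<and> F \<subseteq> N \<and> N \<subseteq> W} \<le>
      inf (principal {N. openin X N \<and> F \<subseteq> N \<and> N \<subseteq> U})
          (principal {N. openin X N \<and> F \<subseteq> N \<and> N \<subseteq> V})"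
    by (rule rev_bexI) auto
qed (auto simp: eventually_principal)

lemma compact_subsets_at_neq_bot: "compact_subsets_at X U \<noteq> bot"
  unfolding trivial_limit_def eventually_compact_subsets_at by blast

lemma open_supersets_at_neq_bot: "F \<subseteq> topspace X \<Longrightarrow> open_supersets_at X F \<noteq> bot"
  unfolding trivial_limit_def by (simp add: eventually_open_supersets_at) blast

lemma eventually_open_superset_within:
  "openin X U \<Longrightarrow> F \<subseteq> U \<Longrightarrow>
     eventually (\<lambda>V. openin X V \<and> F \<subseteq> V \<and> V \<subseteq> U) (open_supersets_at X F)"
  by (subst eventually_open_supersets_at) (auto dest: openin_subset)

text \<open>
  Brings the variations, whose values at closed sets are infima, into the language of limits that
  the axioms use for \<open>\<mu>\<close> itself.
\<close>

lemma mono_tendsto_open_supersets: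
  fixes f :: "'a set \<Rightarrow> ereal"
  assumes "mono f" "F \<subseteq> topspace X"
  shows "(f \<longlongrightarrow> (INF U\<in>{U. openin X U \<and> F \<subseteq> U}. f U)) (open_supersets_at X F)"
proof (rule order_tendstoI)
  fix a assume a: "a < (INF U\<in>{U. openin X U \<and> F \<subseteq> U}. f U)"
  have "eventually (\<lambda>V. openin X V \<and> F \<subseteq> V \<and> V \<subseteq> topspace X) (open_supersets_at X F)"
    using assms(2) by (intro eventually_open_superset_within) auto
  then show "eventually (\<lambda>V. a < f V) (open_supersets_at X F)"
    by eventually_elim (auto intro: less_le_trans[OF a] INF_lower)
next
  fix a assume "(INF U\<in>{U. openin X U \<and> F \<subseteq> U}. f U) < a"
  then obtain U where U: "openin X U" "F \<subseteq> U" "f U < a"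
    by (auto simp: INF_less_iff)
  from eventually_open_superset_within[OF U(1,2)]
  show "eventually (\<lambda>V. f V < a) (open_supersets_at X F)"
    by eventually_elim (metis U(3) assms(1) le_less_trans monoD)
qed

section \<open>Signed topological measures\<close>

lemma stm_additive:
  assumes "signed_topological_measure X \<mu>" "A \<in> ko_sets X" "B \<in> ko_sets X" "A \<union> B \<in> ko_sets X"
    and "A \<inter> B = {}"
  shows "\<mu> (A \<union> B) = \<mu> A + \<mu> B"
  using assms by (simp add: signed_topological_measure_def)

lemma stm_open_limit:
  "signed_topological_measure X \<mu> \<Longrightarrow> openin X U \<Longrightarrow> (\<mu> \<longlongrightarrow> \<mu> U) (compact_subsets_at X U)"
  by (simp add: signed_topological_measure_def)

lemma stm_closed_limit:
  "signed_topological_measure X \<mu> \<Longrightarrow> closedin X F \<Longrightarrow> (\<mu> \<longlongrightarrow> \<mu> F) (open_supersets_at X F)"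
  by (simp add: signed_topological_measure_def)

lemma ko_sets_subset_oc_sets: "Hausdorff_space X \<Longrightarrow> ko_sets X \<subseteq> oc_sets X"
  unfolding ko_sets_def oc_sets_def by (auto intro: compactin_imp_closedin)

lemma stm_one_sided:
  assumes "signed_topological_measure X \<mu>"
  shows "(\<forall>A\<in>oc_sets X. \<mu> A \<noteq> \<infinity>) \<or> (\<forall>A\<in>oc_sets X. \<mu> A \<noteq> -\<infinity>)"
proof -
  have "\<not> ((\<exists>A\<in>oc_sets X. \<mu> A = \<infinity>) \<and> (\<exists>A\<in>oc_sets X. \<mu> A = -\<infinity>))"
    using assms by (simp add: signed_topological_measure_def)
  then show ?thesis
    by blast
qed

text \<open>
  The only delicate axiom is additivity: negation distributes over an extended real sum because
  the values of \<open>\<mu>\<close> do not include both infinities. Every result on the positive variation below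
  has a mirror image for the negative variation through this lemma.
\<close>

lemma stm_uminus:
  assumes H: "Hausdorff_space X" and \<mu>: "signed_topological_measure X \<mu>"
  shows "signed_topological_measure X (\<lambda>A. - \<mu> A)"
proof -
  have add: "- \<mu> (A \<union> B) = - \<mu> A + - \<mu> B"
    if "A \<in> ko_sets X" "B \<in> ko_sets X" "A \<union> B \<in> ko_sets X" "A \<inter> B = {}" for A B
  proof -
    have "A \<in> oc_sets X" "B \<in> oc_sets X"
      using that ko_sets_subset_oc_sets[OF H] by auto
    then show ?thesis
      using stm_one_sided[OF \<mu>] stm_additive[OF \<mu> that]
      by (cases "\<mu> A"; cases "\<mu> B") auto
  qed
  moreover have "((\<lambda>A. - \<mu> A) \<longlongrightarrow> - \<mu> U) (compact_subsets_at X U)" if "openin X U" for U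
    using stm_open_limit[OF \<mu> that] by (rule tendsto_uminus_ereal)
  moreover have "((\<lambda>A. - \<mu> A) \<longlongrightarrow> - \<mu> F) (open_supersets_at X F)" if "closedin X F" for F
    using stm_closed_limit[OF \<mu> that] by (rule tendsto_uminus_ereal)
  moreover have "- \<mu> A = \<infinity> \<longleftrightarrow> \<mu> A = -\<infinity>" "- \<mu> A = -\<infinity> \<longleftrightarrow> \<mu> A = \<infinity>" for A
    by (cases "\<mu> A"; simp)+
  ultimately show ?thesis
    using \<mu> stm_one_sided[OF \<mu>] unfolding signed_topological_measure_def by (simp add: disj_commute)
qed

text \<open>
  From \<open>\<mu> U = \<mu> U + \<mu> {}\<close>, an infinite value at the empty set spreads to all open sets and then, by
  passing to the limit, to all closed sets, which contradicts that \<open>\<mu>\<close> is not identically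
  infinite.
\<close>

lemma stm_empty_neq_infinity:
  assumes \<mu>: "signed_topological_measure X \<mu>"
  shows "\<mu> {} \<noteq> \<infinity>"
proof
  assume inf: "\<mu> {} = \<infinity>"
  have op: "\<mu> U = \<infinity>" if "openin X U" for U
    using stm_additive[OF \<mu>, of U "{}"] that inf by (simp add: ko_sets_def)
  have "\<mu> F = \<infinity>" if F: "closedin X F" for F
  proof -
    have "eventually (\<lambda>V. openin X V \<and> F \<subseteq> V \<and> V \<subseteq> topspace X) (open_supersets_at X F)"
      using closedin_subset[OF F] by (intro eventually_open_superset_within) auto
    then have "eventually (\<lambda>V. \<mu> V = \<infinity>) (open_supersets_at X F)"
      by eventually_elim (simp add: op)
    then have "(\<mu> \<longlongrightarrow> \<infinity>) (open_supersets_at X F)"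
      by (rule tendsto_eventually)
    then show ?thesis
      using tendsto_unique[OF open_supersets_at_neq_bot stm_closed_limit[OF \<mu> F]]
        closedin_subset[OF F] by blast
  qed
  with op have "\<forall>A\<in>oc_sets X. \<mu> A = \<infinity>"
    by (auto simp: oc_sets_def)
  with \<mu> show False
    by (simp add: signed_topological_measure_def)
qed

lemma stm_empty:
  assumes H: "Hausdorff_space X" and \<mu>: "signed_topological_measure X \<mu>"
  shows "\<mu> {} = 0"
proof -
  have "\<mu> {} = \<mu> {} + \<mu> {}"
    using stm_additive[OF \<mu>, of "{}" "{}"] by (simp add: ko_sets_def)
  moreover have "\<mu> {} \<noteq> \<infinity>" "\<mu> {} \<noteq> -\<infinity>"
    using stm_empty_neq_infinity[OF \<mu>] stm_empty_neq_infinity[OF stm_uminus[OF H \<mu>]] by auto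
  ultimately show ?thesis
    by (cases "\<mu> {}") auto
qed

lemma stm_sum_disjoint_compact:
  assumes H: "Hausdorff_space X" and \<mu>: "signed_topological_measure X \<mu>"
    and I: "finite I" and K: "\<forall>i\<in>I. compactin X (K i)" and disj: "disjoint_family_on K I"
  shows "\<mu> (\<Union>i\<in>I. K i) = (\<Sum>i\<in>I. \<mu> (K i))"
  using I K disj
proof (induction I rule: finite_induct)
  case empty
  then show ?case by (simp add: stm_empty[OF H \<mu>])
next
  case (insert i I)
  have "compactin X (\<Union>j\<in>I. K j)"
    using insert.hyps insert.prems by (intro compactin_Union) auto
  moreover have "K i \<inter> (\<Union>j\<in>I. K j) = {}"
    using insert.hyps insert.prems by (auto simp: disjoint_family_on_def)
  ultimately have "\<mu> (K i \<union> (\<Union>j\<in>I. K j)) = \<mu> (K i) + \<mu> (\<Union>j\<in>I. K j)"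
    using insert.prems by (intro stm_additive[OF \<mu>]) (auto simp: ko_sets_def compactin_Un)
  moreover have "\<mu> (\<Union>j\<in>I. K j) = (\<Sum>j\<in>I. \<mu> (K j))"
    using insert.prems by (intro insert.IH) (simp_all add: disjoint_family_on_def)
  ultimately show ?case
    using insert.hyps by simp
qed

text \<open>
  The set function \<open>\<mu>\<close> is not monotone, so this splitting is what relates its value at \<open>U\<close> to its
  values at compact subsets. It underlies both \<open>\<mu> = \<mu>\<^sup>+ - \<mu>\<^sup>-\<close> and the lower bound for \<open>\<bar>\<mu>\<bar>\<close>.
\<close>

lemma stm_open_diff_compact:
  assumes H: "Hausdorff_space X" and \<mu>: "signed_topological_measure X \<mu>"
    and "openin X U" "compactin X C" "C \<subseteq> U"
  shows "\<mu> U = \<mu> C + \<mu> (U - C)"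
proof -
  have "openin X (U - C)"
    using assms by (intro openin_diff compactin_imp_closedin) auto
  moreover have "C \<union> (U - C) = U"
    using assms by auto
  ultimately show ?thesis
    using stm_additive[OF \<mu>, of C "U - C"] assms by (simp add: ko_sets_def)
qed

section \<open>The positive variation\<close>

lemma pos_var_open_eq: "openin X U \<Longrightarrow> pos_var X \<mu> U = pos_var_open X \<mu> U"
  by (simp add: pos_var_def)

lemma pos_var_mono: "mono (pos_var X \<mu>)"
proof
  fix A B :: "'a set" assume "A \<subseteq> B"
  then show "pos_var X \<mu> A \<le> pos_var X \<mu> B"
    by (auto simp: pos_var_def intro!: INF_greatest INF_lower2 pos_var_open_mono)
qed

lemma pos_var_ge_compact:
  assumes "compactin X K" "openin X U" "K \<subseteq> U"
  shows "\<mu> K \<le> pos_var X \<mu> U"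
  using assms by (auto simp: pos_var_open_eq pos_var_open_def intro: SUP_upper)

lemma pos_var_le_iff:
  "openin X U \<Longrightarrow> pos_var X \<mu> U \<le> a \<longleftrightarrow> (\<forall>K. compactin X K \<longrightarrow> K \<subseteq> U \<longrightarrow> \<mu> K \<le> a)"
  by (auto simp: pos_var_open_eq pos_var_open_def SUP_le_iff)

lemma pos_var_nonneg:
  assumes "Hausdorff_space X" "signed_topological_measure X \<mu>"
  shows "0 \<le> pos_var X \<mu> A"
proof -
  have "0 \<le> pos_var X \<mu> {}"
    using pos_var_ge_compact[of X "{}" "{}" \<mu>] stm_empty[OF assms] by simp
  also have "\<dots> \<le> pos_var X \<mu> A"
    by (rule monoD[OF pos_var_mono]) simp
  finally show ?thesis .
qed

text \<open>
  On compact sets this is the definition of the supremum; the two limit axioms carry it to open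
  and then to closed sets.
\<close>

lemma le_pos_var:
  assumes H: "Hausdorff_space X" and \<mu>: "signed_topological_measure X \<mu>" and A: "A \<in> oc_sets X"
  shows "\<mu> A \<le> pos_var X \<mu> A"
proof -
  have op: "\<mu> U \<le> pos_var X \<mu> U" if U: "openin X U" for U
  proof (rule tendsto_upperbound[OF stm_open_limit[OF \<mu> U] _ compact_subsets_at_neq_bot])
    show "eventually (\<lambda>K. \<mu> K \<le> pos_var X \<mu> U) (compact_subsets_at X U)"
      unfolding eventually_compact_subsets_at
      using U by (auto intro!: exI[of _ "{}"] pos_var_ge_compact)
  qed
  have "\<mu> F \<le> pos_var X \<mu> F" if F: "closedin X F" for F
    unfolding pos_var_closed[OF F]
  proof (rule INF_greatest)
    fix U assume "U \<in> {U. openin X U \<and> F \<subseteq> U}"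
    then have "eventually (\<lambda>V. openin X V \<and> F \<subseteq> V \<and> V \<subseteq> U) (open_supersets_at X F)"
      by (intro eventually_open_superset_within) auto
    then have "eventually (\<lambda>V. \<mu> V \<le> pos_var X \<mu> U) (open_supersets_at X F)"
      by eventually_elim (meson monoD op order_trans pos_var_mono)
    then show "\<mu> F \<le> pos_var X \<mu> U"
      using tendsto_upperbound[OF stm_closed_limit[OF \<mu> F]]
        open_supersets_at_neq_bot[OF closedin_subset[OF F]] by blast
  qed
  with op A show ?thesis
    unfolding oc_sets_def by blast
qed

text \<open>
  A compact subset of \<open>U \<union> V\<close> splits into the compact pieces \<open>K - V \<subseteq> U\<close> and \<open>K - U \<subseteq> V\<close>, and
  conversely compact subsets of \<open>U\<close> and \<open>V\<close> may be joined.
\<close>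

lemma pos_var_additive_open:
  assumes H: "Hausdorff_space X" and \<mu>: "signed_topological_measure X \<mu>"
    and U: "openin X U" and V: "openin X V" and disj: "U \<inter> V = {}"
  shows "pos_var X \<mu> (U \<union> V) = pos_var X \<mu> U + pos_var X \<mu> V"
proof (rule antisym)
  have UV: "openin X (U \<union> V)"
    using U V by blast
  show "pos_var X \<mu> (U \<union> V) \<le> pos_var X \<mu> U + pos_var X \<mu> V"
    unfolding pos_var_le_iff[OF UV]
  proof (intro allI impI)
    fix K assume K: "compactin X K" "K \<subseteq> U \<union> V"
    have "compactin X (K - V)" "compactin X (K - U)"
      using compactin_imp_closedin[OF H K(1)] K(1) U V
      by (auto intro!: closed_compactin[OF K(1)] closedin_diff)
    moreover have "(K - V) \<union> (K - U) = K"
      using K disj by auto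
    ultimately have "\<mu> K = \<mu> (K - V) + \<mu> (K - U)"
      using stm_additive[OF \<mu>, of "K - V" "K - U"] K by (auto simp: ko_sets_def)
    also have "\<dots> \<le> pos_var X \<mu> U + pos_var X \<mu> V"
      using \<open>compactin X (K - V)\<close> \<open>compactin X (K - U)\<close> K U V
      by (intro add_mono pos_var_ge_compact) auto
    finally show "\<mu> K \<le> pos_var X \<mu> U + pos_var X \<mu> V" .
  qed
  let ?S = "\<lambda>W. {K. compactin X K \<and> K \<subseteq> W}"
  have bound: "\<mu> C + \<mu> K \<le> pos_var X \<mu> (U \<union> V)"
    if "C \<in> ?S U" "K \<in> ?S V" for C K
  proof -
    have "\<mu> C + \<mu> K = \<mu> (C \<union> K)"
      using that disj by (subst stm_additive[OF \<mu>]) (auto simp: ko_sets_def compactin_Un)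
    also have "\<dots> \<le> pos_var X \<mu> (U \<union> V)"
      using that UV by (intro pos_var_ge_compact) (auto simp: compactin_Un)
    finally show ?thesis .
  qed
  have pv: "pos_var X \<mu> W = (SUP K\<in>?S W. \<mu> K)" if "openin X W" for W
    using that by (simp add: pos_var_open_eq pos_var_open_def)
  show "pos_var X \<mu> U + pos_var X \<mu> V \<le> pos_var X \<mu> (U \<union> V)"
  proof (cases "pos_var X \<mu> (U \<union> V) = \<infinity>")
    case False
    have "pos_var X \<mu> U \<noteq> -\<infinity>" "pos_var X \<mu> V \<noteq> -\<infinity>"
      using pos_var_nonneg[OF H \<mu>] by (metis MInfty_neq_PInfty(1) ereal_infty_less_eq(2) not_MInfty_nonneg)+
    moreover have "pos_var X \<mu> U \<le> pos_var X \<mu> (U \<union> V)" "pos_var X \<mu> V \<le> pos_var X \<mu> (U \<union> V)"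
      by (auto intro: monoD[OF pos_var_mono])
    ultimately obtain r u v where fin: "pos_var X \<mu> (U \<union> V) = ereal r"
      "pos_var X \<mu> U = ereal u" "pos_var X \<mu> V = ereal v"
      using False
      by (cases "pos_var X \<mu> (U \<union> V)"; cases "pos_var X \<mu> U"; cases "pos_var X \<mu> V") auto
    show ?thesis
    proof (rule ereal_le_epsilon2)
      fix e :: real assume e: "0 < e"
      have "ereal (u - e/2) < (SUP K\<in>?S U. \<mu> K)" "ereal (v - e/2) < (SUP K\<in>?S V. \<mu> K)"
        using e fin pv[OF U] pv[OF V] by auto
      then obtain C K where CK: "C \<in> ?S U" "K \<in> ?S V"
        "ereal (u - e/2) < \<mu> C" "ereal (v - e/2) < \<mu> K"
        unfolding less_SUP_iff by blast
      then show "pos_var X \<mu> U + pos_var X \<mu> V \<le> pos_var X \<mu> (U \<union> V) + ereal e"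
        using bound[OF CK(1,2)] unfolding fin by (cases "\<mu> C"; cases "\<mu> K") auto
    qed
  qed auto
qed

text \<open>
  Intersecting arbitrary open supersets with fixed disjoint neighbourhoods \<open>U\<close> of \<open>C\<close> and \<open>V\<close> of \<open>K\<close>
  reduces the claim to additivity on disjoint open sets.
\<close>

lemma pos_var_additive_compact:
  assumes H: "Hausdorff_space X" and \<mu>: "signed_topological_measure X \<mu>"
    and C: "compactin X C" and K: "compactin X K" and disj: "C \<inter> K = {}"
  shows "pos_var X \<mu> (C \<union> K) = pos_var X \<mu> C + pos_var X \<mu> K"
proof -
  obtain U V where UV: "openin X U" "openin X V" "C \<subseteq> U" "K \<subseteq> V" "disjnt U V"
    using Hausdorff_space_compact_separation[OF H C K] disj by (auto simp: disjnt_def)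
  have UV': "A \<inter> U \<inter> (B \<inter> V) = {}" for A B
    using UV(5) by (auto simp: disjnt_def)
  let ?O = "\<lambda>F. {U. openin X U \<and> F \<subseteq> U}"
  have cl: "closedin X C" "closedin X K" "closedin X (C \<union> K)"
    using C K compactin_imp_closedin[OF H] by auto
  have nn: "0 \<le> pos_var X \<mu> A" for A
    by (rule pos_var_nonneg[OF H \<mu>])
  show ?thesis
  proof (rule antisym)
    have le: "pos_var X \<mu> (C \<union> K) \<le> pos_var X \<mu> A + pos_var X \<mu> B"
      if "A \<in> ?O C" "B \<in> ?O K" for A B
    proof -
      have "pos_var X \<mu> (C \<union> K) \<le> pos_var X \<mu> ((A \<inter> U) \<union> (B \<inter> V))"
        using that UV by (intro monoD[OF pos_var_mono]) auto
      also have "\<dots> = pos_var X \<mu> (A \<inter> U) + pos_var X \<mu> (B \<inter> V)"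
        using that UV UV' by (intro pos_var_additive_open[OF H \<mu>]) auto
      also have "\<dots> \<le> pos_var X \<mu> A + pos_var X \<mu> B"
        by (intro add_mono monoD[OF pos_var_mono]) auto
      finally show ?thesis .
    qed
    have ne: "?O C \<noteq> {}" "?O K \<noteq> {}"
      using UV by auto
    have "0 \<le> (INF B\<in>?O K. pos_var X \<mu> B)"
      by (intro INF_greatest nn)
    then have INF_nn: "(INF B\<in>?O K. pos_var X \<mu> B) \<noteq> -\<infinity>"
      by auto
    \<comment> \<open>Nonnegativity lets the two infima be pulled out of the sum one after the other.\<close>
    have "pos_var X \<mu> C + pos_var X \<mu> K = (INF A\<in>?O C. INF B\<in>?O K. pos_var X \<mu> A + pos_var X \<mu> B)"
      using nn ne INF_nn unfolding pos_var_closed[OF cl(1)] pos_var_closed[OF cl(2)]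
      by (subst INF_ereal_add_left[symmetric])
         (auto intro!: INF_cong INF_ereal_add_right[symmetric])
    also have "\<dots> \<ge> pos_var X \<mu> (C \<union> K)"
      by (intro INF_greatest le)
    finally show "pos_var X \<mu> (C \<union> K) \<le> pos_var X \<mu> C + pos_var X \<mu> K" .
    show "pos_var X \<mu> C + pos_var X \<mu> K \<le> pos_var X \<mu> (C \<union> K)"
      unfolding pos_var_closed[OF cl(3)]
    proof (rule INF_greatest)
      fix W assume W: "W \<in> ?O (C \<union> K)"
      have "pos_var X \<mu> C + pos_var X \<mu> K \<le> pos_var X \<mu> (W \<inter> U) + pos_var X \<mu> (W \<inter> V)"
        using W UV by (intro add_mono monoD[OF pos_var_mono]) auto
      also have "\<dots> = pos_var X \<mu> ((W \<inter> U) \<union> (W \<inter> V))"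
        using W UV UV' by (intro pos_var_additive_open[OF H \<mu>, symmetric]) auto
      also have "\<dots> \<le> pos_var X \<mu> W"
        by (intro monoD[OF pos_var_mono]) auto
      finally show "pos_var X \<mu> C + pos_var X \<mu> K \<le> pos_var X \<mu> W" .
    qed
  qed
qed

lemma pos_var_deficient:
  assumes H: "Hausdorff_space X" and \<mu>: "signed_topological_measure X \<mu>"
  shows "deficient_topological_measure X (pos_var X \<mu>)"
proof -
  have "pos_var X \<mu> {} = 0"
    using stm_empty[OF H \<mu>] pos_var_le_iff[of X "{}" \<mu> 0] pos_var_nonneg[OF H \<mu>, of "{}"]
    by (intro antisym) auto
  then have "\<not> (\<forall>A\<in>oc_sets X. pos_var X \<mu> A = \<infinity>)"
    by (auto simp: oc_sets_def intro!: exI[of _ "{}"])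
  moreover have "pos_var X \<mu> U = (SUP C\<in>{C. compactin X C \<and> C \<subseteq> U}. pos_var X \<mu> C)"
    if U: "openin X U" for U
  proof (rule antisym)
    have "\<mu> K \<le> pos_var X \<mu> K" if "compactin X K" for K
      using that compactin_imp_closedin[OF H] by (intro le_pos_var[OF H \<mu>]) (auto simp: oc_sets_def)
    then show "pos_var X \<mu> U \<le> (SUP C\<in>{C. compactin X C \<and> C \<subseteq> U}. pos_var X \<mu> C)"
      unfolding pos_var_le_iff[OF U] by (auto intro!: SUP_upper2)
    show "(SUP C\<in>{C. compactin X C \<and> C \<subseteq> U}. pos_var X \<mu> C) \<le> pos_var X \<mu> U"
      by (auto intro!: SUP_least monoD[OF pos_var_mono])
  qed
  ultimately show ?thesis
    using pos_var_nonneg[OF H \<mu>] pos_var_additive_compact[OF H \<mu>]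
    unfolding deficient_topological_measure_def by (simp add: pos_var_closed)
qed

text \<open>
  Inner regularity of \<open>\<nu>\<close> expresses its value at an open set through compact sets, where it
  dominates \<open>\<mu>\<close>.
\<close>

lemma pos_var_le_deficient:
  assumes H: "Hausdorff_space X" and \<nu>: "deficient_topological_measure X \<nu>"
    and le: "\<forall>A\<in>oc_sets X. \<mu> A \<le> \<nu> A" and A: "A \<in> oc_sets X"
  shows "pos_var X \<mu> A \<le> \<nu> A"
proof -
  have op: "pos_var X \<mu> U \<le> \<nu> U" if U: "openin X U" for U
  proof -
    have "\<mu> K \<le> \<nu> K" if "compactin X K" for K
      using le that compactin_imp_closedin[OF H] by (auto simp: oc_sets_def)
    moreover have "\<nu> U = (SUP C\<in>{C. compactin X C \<and> C \<subseteq> U}. \<nu> C)"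
      using \<nu> U unfolding deficient_topological_measure_def by simp
    ultimately show ?thesis
      unfolding pos_var_le_iff[OF U] by (auto intro!: SUP_upper2)
  qed
  have "pos_var X \<mu> F \<le> \<nu> F" if F: "closedin X F" for F
  proof -
    have "\<nu> F = (INF U\<in>{U. openin X U \<and> F \<subseteq> U}. \<nu> U)"
      using \<nu> F unfolding deficient_topological_measure_def by simp
    then show ?thesis
      unfolding pos_var_closed[OF F] using op by (auto intro!: INF_mono)
  qed
  with op A show ?thesis
    unfolding oc_sets_def by blast
qed

lemma pos_var_unique_smallest:
  assumes H: "Hausdorff_space X" and \<mu>: "signed_topological_measure X \<mu>"
  shows "unique_smallest_on (oc_sets X)
     {\<nu>. deficient_topological_measure X \<nu> \<and> (\<forall>A\<in>oc_sets X. \<mu> A \<le> \<nu> A)} (pos_var X \<mu>)"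
proof -
  have "smallest_on (oc_sets X)
     {\<nu>. deficient_topological_measure X \<nu> \<and> (\<forall>A\<in>oc_sets X. \<mu> A \<le> \<nu> A)} (pos_var X \<mu>)"
    using pos_var_deficient[OF H \<mu>] le_pos_var[OF H \<mu>] pos_var_le_deficient[OF H]
    unfolding smallest_on_def by blast
  then show ?thesis
    unfolding unique_smallest_on_def smallest_on_def by (meson antisym)
qed

section \<open>The negative variation\<close>

lemma neg_var_uminus: "neg_var X (\<lambda>A. - \<mu> A) = pos_var X \<mu>"
  by (simp add: neg_var_def)

lemma neg_var_nonneg:
  assumes "Hausdorff_space X" "signed_topological_measure X \<mu>"
  shows "0 \<le> neg_var X \<mu> A"
  unfolding neg_var_def by (rule pos_var_nonneg[OF assms(1) stm_uminus[OF assms]])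

lemma uminus_le_neg_var:
  assumes "Hausdorff_space X" "signed_topological_measure X \<mu>" "A \<in> oc_sets X"
  shows "- \<mu> A \<le> neg_var X \<mu> A"
  unfolding neg_var_def by (rule le_pos_var[OF assms(1) stm_uminus[OF assms(1,2)] assms(3)])

lemma neg_var_mono: "mono (neg_var X \<mu>)"
  unfolding neg_var_def by (rule pos_var_mono)

lemma neg_var_unique_smallest:
  assumes H: "Hausdorff_space X" and \<mu>: "signed_topological_measure X \<mu>"
  shows "unique_smallest_on (oc_sets X)
     {\<nu>. deficient_topological_measure X \<nu> \<and> (\<forall>A\<in>oc_sets X. - \<nu> A \<le> \<mu> A)} (neg_var X \<mu>)"
proof -
  have "- a \<le> \<mu> A \<longleftrightarrow> - \<mu> A \<le> a" for a A
    by (rule ereal_uminus_le_reorder)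
  then show ?thesis
    using pos_var_unique_smallest[OF H stm_uminus[OF H \<mu>]]
    unfolding neg_var_def by (simp only:)
qed

lemma uminus_largest_on:
  assumes "smallest_on D S f"
  shows "largest_on D {(\<lambda>A. - g A) | g. g \<in> S} (\<lambda>A. - f A)"
  unfolding largest_on_def
proof (intro conjI ballI)
  show "(\<lambda>A. - f A) \<in> {(\<lambda>A. - g A) | g. g \<in> S}"
    using assms unfolding smallest_on_def by blast
next
  fix h A assume "h \<in> {(\<lambda>A. - g A) | g. g \<in> S}" "A \<in> D"
  then show "h A \<le> - f A"
    using assms unfolding smallest_on_def by auto
qed

section \<open>The difference of the two variations\<close>

text \<open>
  For compact \<open>C \<subseteq> U\<close> one has \<open>\<mu> C = \<mu> U - \<mu> (U - C)\<close>, and the subtracted term is controlled by the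
  negative variation of \<open>U\<close>. The extended real convention \<open>-\<infinity> + \<infinity> = \<infinity>\<close> makes the inequality
  true when \<open>\<mu> U = -\<infinity>\<close>, where the negative variation is infinite.
\<close>

lemma pos_var_open_le_add_neg_var:
  assumes H: "Hausdorff_space X" and \<mu>: "signed_topological_measure X \<mu>" and U: "openin X U"
  shows "pos_var X \<mu> U \<le> \<mu> U + neg_var X \<mu> U"
  unfolding pos_var_le_iff[OF U]
proof (intro allI impI)
  fix C assume C: "compactin X C" "C \<subseteq> U"
  have "openin X (U - C)"
    using compactin_imp_closedin[OF H C(1)] U by blast
  then have "- \<mu> (U - C) \<le> neg_var X \<mu> (U - C)"
    unfolding neg_var_def by (intro le_pos_var[OF H stm_uminus[OF H \<mu>]]) (auto simp: oc_sets_def)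
  also have "\<dots> \<le> neg_var X \<mu> U"
    unfolding neg_var_def by (intro monoD[OF pos_var_mono]) auto
  finally have "- \<mu> (U - C) \<le> neg_var X \<mu> U" .
  moreover have "0 \<le> neg_var X \<mu> U"
    unfolding neg_var_def by (rule pos_var_nonneg[OF H stm_uminus[OF H \<mu>]])
  ultimately show "\<mu> C \<le> \<mu> U + neg_var X \<mu> U"
    unfolding stm_open_diff_compact[OF H \<mu> U C]
    by (cases "\<mu> C"; cases "\<mu> (U - C)"; cases "neg_var X \<mu> U") auto
qed

text \<open>
  The previous inequality for \<open>\<mu>\<close> and for \<open>-\<mu>\<close> gives the two halves. When exactly one variation is
  infinite, one of the two inequalities forces \<open>\<mu> U\<close> to be the matching infinity.
\<close>

lemma jordan_decomposition_open:
  assumes H: "Hausdorff_space X" and \<mu>: "signed_topological_measure X \<mu>" and U: "openin X U"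
    and fin: "pos_var X \<mu> U < \<infinity> \<or> neg_var X \<mu> U < \<infinity>"
  shows "\<mu> U = pos_var X \<mu> U - neg_var X \<mu> U"
proof -
  have "pos_var X \<mu> U \<le> \<mu> U + neg_var X \<mu> U"
    by (rule pos_var_open_le_add_neg_var[OF H \<mu> U])
  moreover have "neg_var X \<mu> U \<le> - \<mu> U + pos_var X \<mu> U"
    using pos_var_open_le_add_neg_var[OF H stm_uminus[OF H \<mu>] U]
    by (simp add: neg_var_uminus flip: neg_var_def)
  moreover have "0 \<le> pos_var X \<mu> U" "0 \<le> neg_var X \<mu> U"
    using pos_var_nonneg[OF H \<mu>] neg_var_nonneg[OF H \<mu>] by auto
  ultimately show ?thesis
    using fin by (cases "\<mu> U"; cases "pos_var X \<mu> U"; cases "neg_var X \<mu> U") auto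
qed

text \<open>
  At a closed set both sides are limits along the net of open supersets. Finiteness of one
  variation rules out \<open>\<infinity> - \<infinity>\<close>, so the difference of the limits is the limit of the differences.
\<close>

lemma jordan_decomposition:
  assumes H: "Hausdorff_space X" and \<mu>: "signed_topological_measure X \<mu>" and A: "A \<in> oc_sets X"
    and fin: "finite_set_function X (pos_var X \<mu>) \<or> finite_set_function X (neg_var X \<mu>)"
  shows "\<mu> A = pos_var X \<mu> A - neg_var X \<mu> A"
proof -
  have fin': "pos_var X \<mu> B < \<infinity> \<or> neg_var X \<mu> B < \<infinity>" if "B \<subseteq> topspace X" for B
    using fin monoD[OF pos_var_mono that] monoD[OF neg_var_mono that]
    unfolding finite_set_function_def by (meson le_less_trans)
  have op: "\<mu> U = pos_var X \<mu> U - neg_var X \<mu> U" if "openin X U" for U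
    using that fin' openin_subset by (intro jordan_decomposition_open[OF H \<mu>]) auto
  have cl: "\<mu> F = pos_var X \<mu> F - neg_var X \<mu> F" if F: "closedin X F" for F
  proof (rule tendsto_unique[OF open_supersets_at_neq_bot stm_closed_limit[OF \<mu> F]])
    have F': "F \<subseteq> topspace X"
      using F by (rule closedin_subset)
    then show "F \<subseteq> topspace X" .
    have "(pos_var X \<mu> \<longlongrightarrow> pos_var X \<mu> F) (open_supersets_at X F)"
      "(neg_var X \<mu> \<longlongrightarrow> neg_var X \<mu> F) (open_supersets_at X F)"
      using mono_tendsto_open_supersets[OF pos_var_mono F'] pos_var_closed[OF F]
      unfolding neg_var_def by metis+
    moreover have "pos_var X \<mu> F \<noteq> -\<infinity>" "neg_var X \<mu> F \<noteq> -\<infinity>"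
      using pos_var_nonneg[OF H \<mu>, of F] neg_var_nonneg[OF H \<mu>, of F] by auto
    ultimately have "((\<lambda>U. pos_var X \<mu> U + - neg_var X \<mu> U) \<longlongrightarrow> pos_var X \<mu> F + - neg_var X \<mu> F)
        (open_supersets_at X F)"
      using fin'[OF F'] by (intro tendsto_add_ereal_general tendsto_uminus_ereal) auto
    then have lim: "((\<lambda>U. pos_var X \<mu> U - neg_var X \<mu> U) \<longlongrightarrow> pos_var X \<mu> F - neg_var X \<mu> F)
        (open_supersets_at X F)"
      by (simp add: minus_ereal_def)
    have "eventually (\<lambda>V. openin X V \<and> F \<subseteq> V \<and> V \<subseteq> topspace X) (open_supersets_at X F)"
      using F' by (intro eventually_open_superset_within) auto
    then have "eventually (\<lambda>U. pos_var X \<mu> U - neg_var X \<mu> U = \<mu> U) (open_supersets_at X F)"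
      by eventually_elim (simp add: op)
    then show "(\<mu> \<longlongrightarrow> pos_var X \<mu> F - neg_var X \<mu> F) (open_supersets_at X F)"
      using lim by (rule Lim_transform_eventually[rotated])
  qed
  from A consider "openin X A" | "closedin X A"
    unfolding oc_sets_def by blast
  then show ?thesis
    by cases (rule op cl, assumption)+
qed

lemma finite_pos_var_of_norm:
  assumes "stm_norm X \<mu> < \<infinity>"
  shows "finite_set_function X (pos_var X \<mu>)"
proof -
  have "pos_var X \<mu> (topspace X) \<le> stm_norm X \<mu>"
    unfolding pos_var_le_iff[OF openin_topspace]
  proof (intro allI impI)
    fix K assume "compactin X K"
    then have "\<bar>\<mu> K\<bar> \<le> stm_norm X \<mu>"
      unfolding stm_norm_def by (intro SUP_upper) simp
    moreover have "\<mu> K \<le> \<bar>\<mu> K\<bar>"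
      by (cases "\<mu> K") auto
    ultimately show "\<mu> K \<le> stm_norm X \<mu>"
      by (rule order_trans[rotated])
  qed
  with assms show ?thesis
    unfolding finite_set_function_def by (meson le_less_trans)
qed

section \<open>The total variation\<close>

lemma total_var_open_eq: "openin X U \<Longrightarrow> total_var X \<mu> U = total_var_open X \<mu> U"
  by (simp add: total_var_def)

lemma sum_abs_le_total_var:
  assumes "openin X U" "\<forall>i<n. compactin X (K i)" "disjoint_family_on K {..<n::nat}"
    "(\<Union>i<n. K i) \<subseteq> U"
  shows "(\<Sum>i<n. \<bar>\<mu> (K i)\<bar>) \<le> total_var X \<mu> U"
  unfolding total_var_open_eq[OF assms(1)] total_var_open_def
  using assms by (intro Sup_upper CollectI exI[of _ n] exI[of _ K]) simp

lemma total_var_ge_disjoint_pair: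
  assumes U: "openin X U" and K: "compactin X K" and L: "compactin X L" "K \<inter> L = {}" "K \<union> L \<subseteq> U"
  shows "\<bar>\<mu> K\<bar> + \<bar>\<mu> L\<bar> \<le> total_var X \<mu> U"
proof -
  define F where "F i = (if i = 0 then K else L)" for i :: nat
  have "{..<2::nat} = {0, 1}"
    by auto
  then show ?thesis
    using sum_abs_le_total_var[OF U, of 2 F \<mu>] assms
    by (auto simp: F_def disjoint_family_on_def less_2_cases_iff)
qed

text \<open>
  By finite additivity, the sets with \<open>\<mu> \<ge> 0\<close> in a disjoint compact family contribute the value of \<open>\<mu>\<close>
  at their union, and the others the value of \<open>-\<mu>\<close> at theirs.
\<close>

lemma total_var_le_pos_add_neg_open:
  assumes H: "Hausdorff_space X" and \<mu>: "signed_topological_measure X \<mu>" and U: "openin X U"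
  shows "total_var X \<mu> U \<le> pos_var X \<mu> U + neg_var X \<mu> U"
  unfolding total_var_open_eq[OF U] total_var_open_def
proof (rule Sup_least, clarify)
  fix n :: nat and K
  assume K: "\<forall>i<n. compactin X (K i)" "disjoint_family_on K {..<n}" "(\<Union>i<n. K i) \<subseteq> U"
  let ?P = "{i\<in>{..<n}. 0 \<le> \<mu> (K i)}" and ?N = "{i\<in>{..<n}. \<not> 0 \<le> \<mu> (K i)}"
  have part: "(\<Sum>i\<in>I. \<mu>' (K i)) \<le> pos_var X \<mu>' U"
    if "signed_topological_measure X \<mu>'" "I \<subseteq> {..<n}" for I \<mu>'
  proof -
    have I: "finite I" "\<forall>i\<in>I. compactin X (K i)" "disjoint_family_on K I"
      using that K finite_subset[OF that(2)] by (auto intro: disjoint_family_on_mono)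
    have "(\<Sum>i\<in>I. \<mu>' (K i)) = \<mu>' (\<Union>i\<in>I. K i)"
      by (rule stm_sum_disjoint_compact[OF H that(1) I, symmetric])
    also have "\<dots> \<le> pos_var X \<mu>' U"
    proof (rule pos_var_ge_compact[OF _ U])
      show "compactin X (\<Union>i\<in>I. K i)"
        using I by (intro compactin_Union) auto
      show "(\<Union>i\<in>I. K i) \<subseteq> U"
        using K that by blast
    qed
    finally show ?thesis .
  qed
  have "(\<Sum>i<n. \<bar>\<mu> (K i)\<bar>) = (\<Sum>i\<in>?P. \<bar>\<mu> (K i)\<bar>) + (\<Sum>i\<in>?N. \<bar>\<mu> (K i)\<bar>)"
    by (subst sum.union_disjoint[symmetric]) (auto intro!: sum.cong)
  also have "(\<Sum>i\<in>?P. \<bar>\<mu> (K i)\<bar>) = (\<Sum>i\<in>?P. \<mu> (K i))"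
    by (intro sum.cong) auto
  also have "(\<Sum>i\<in>?N. \<bar>\<mu> (K i)\<bar>) = (\<Sum>i\<in>?N. - \<mu> (K i))"
    by (intro sum.cong) auto
  also have "(\<Sum>i\<in>?P. \<mu> (K i)) + (\<Sum>i\<in>?N. - \<mu> (K i)) \<le> pos_var X \<mu> U + neg_var X \<mu> U"
    unfolding neg_var_def
    by (intro add_mono part \<mu> stm_uminus[OF H \<mu>]) auto
  finally show "(\<Sum>i<n. \<bar>\<mu> (K i)\<bar>) \<le> pos_var X \<mu> U + neg_var X \<mu> U" .
qed

lemma pos_var_le_total_var_open:
  assumes U: "openin X U"
  shows "pos_var X \<mu> U \<le> total_var X \<mu> U"
  unfolding pos_var_le_iff[OF U]
proof (intro allI impI)
  fix K assume "compactin X K" "K \<subseteq> U"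
  then have "\<bar>\<mu> K\<bar> + \<bar>\<mu> {}\<bar> \<le> total_var X \<mu> U"
    using U by (intro total_var_ge_disjoint_pair) auto
  moreover have "\<mu> K \<le> \<bar>\<mu> K\<bar> + \<bar>\<mu> {}\<bar>"
    by (cases "\<mu> K"; cases "\<mu> {}") auto
  ultimately show "\<mu> K \<le> total_var X \<mu> U"
    by (rule order_trans[rotated])
qed

lemma total_var_uminus: "total_var X (\<lambda>A. - \<mu> A) = total_var X \<mu>"
proof -
  have "\<bar>- x\<bar> = \<bar>x\<bar>" for x :: ereal
    by (cases x) simp_all
  then show ?thesis
    unfolding total_var_def total_var_open_def by (simp only:)
qed

text \<open>
  Compact sets that nearly attain the two variations can overlap, so they do not form an admissible family
  for the total variation. Disjointness is enforced by pairing \<open>K\<close> with compact subsets of \<open>U - K\<close>;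
  the additivity \<open>\<mu> U = \<mu> K + \<mu> (U - K)\<close> shows that nothing is lost: writing \<open>t\<close>, \<open>p\<close>, \<open>q\<close> for the
  values of the three variations at \<open>U\<close>, one gets \<open>2 \<mu> K \<le> t + \<mu> U = t + (p - q)\<close>, hence
  \<open>2 p \<le> t + p - q\<close>.
\<close>

lemma pos_add_neg_le_total_var_open:
  assumes H: "Hausdorff_space X" and \<mu>: "signed_topological_measure X \<mu>" and U: "openin X U"
  shows "pos_var X \<mu> U + neg_var X \<mu> U \<le> total_var X \<mu> U"
proof (cases "total_var X \<mu> U = \<infinity>")
  case False
  have "pos_var X \<mu> U \<le> total_var X \<mu> U" "neg_var X \<mu> U \<le> total_var X \<mu> U"
    using pos_var_le_total_var_open[OF U, of \<mu>] pos_var_le_total_var_open[OF U, of "\<lambda>A. - \<mu> A"]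
    by (simp_all add: neg_var_def total_var_uminus)
  moreover have nn: "0 \<le> pos_var X \<mu> U" "0 \<le> neg_var X \<mu> U"
    using pos_var_nonneg[OF H \<mu>] neg_var_nonneg[OF H \<mu>] by auto
  ultimately obtain p q t where pqt:
    "pos_var X \<mu> U = ereal p" "neg_var X \<mu> U = ereal q" "total_var X \<mu> U = ereal t"
    using False
    by (cases "pos_var X \<mu> U"; cases "neg_var X \<mu> U"; cases "total_var X \<mu> U") auto
  have \<mu>U: "\<mu> U = ereal (p - q)"
    using jordan_decomposition_open[OF H \<mu> U] pqt by simp
  \<comment> \<open>The bound is equivalent to \<open>p + q \<le> t\<close>.\<close>
  have "pos_var X \<mu> U \<le> ereal ((t + (p - q)) / 2)"
    unfolding pos_var_le_iff[OF U]
  proof (intro allI impI)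
    fix K assume K: "compactin X K" "K \<subseteq> U"
    have UK: "openin X (U - K)"
      using compactin_imp_closedin[OF H K(1)] U by blast
    have \<mu>_split: "ereal (p - q) = \<mu> K + \<mu> (U - K)"
      using stm_open_diff_compact[OF H \<mu> U K] \<mu>U by simp
    then obtain k where k: "\<mu> K = ereal k"
      by (cases "\<mu> K"; cases "\<mu> (U - K)") auto
    have "- \<mu> L \<le> ereal (t - k)" if L: "compactin X L" "L \<subseteq> U - K" for L
    proof -
      have "\<bar>\<mu> K\<bar> + \<bar>\<mu> L\<bar> \<le> total_var X \<mu> U"
        using L K U by (intro total_var_ge_disjoint_pair) auto
      then show ?thesis
        unfolding k pqt by (cases "\<mu> L") auto
    qed
    then have "neg_var X \<mu> (U - K) \<le> ereal (t - k)"
      unfolding neg_var_def pos_var_le_iff[OF UK] by blast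
    moreover have "- \<mu> (U - K) \<le> neg_var X \<mu> (U - K)"
      using UK by (intro uminus_le_neg_var[OF H \<mu>]) (simp add: oc_sets_def)
    ultimately have "- \<mu> (U - K) \<le> ereal (t - k)"
      by (rule order_trans[rotated])
    then show "\<mu> K \<le> ereal ((t + (p - q)) / 2)"
      using \<mu>_split unfolding k by (cases "\<mu> (U - K)") auto
  qed
  then show ?thesis
    unfolding pqt by (simp add: field_simps)
qed auto

text \<open>
  For a closed set the infimum of the sum over open supersets is the sum of the infima, because
  two open supersets have their intersection as a common refinement.
\<close>

lemma total_var_eq_pos_add_neg:
  assumes H: "Hausdorff_space X" and \<mu>: "signed_topological_measure X \<mu>" and A: "A \<in> oc_sets X"
  shows "total_var X \<mu> A = pos_var X \<mu> A + neg_var X \<mu> A"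
proof -
  have op: "total_var X \<mu> U = pos_var X \<mu> U + neg_var X \<mu> U" if "openin X U" for U
    using total_var_le_pos_add_neg_open[OF H \<mu> that] pos_add_neg_le_total_var_open[OF H \<mu> that]
    by (rule antisym)
  have cl: "total_var X \<mu> F = pos_var X \<mu> F + neg_var X \<mu> F" if F: "closedin X F" for F
  proof -
    let ?O = "{U. openin X U \<and> F \<subseteq> U}"
    have "total_var X \<mu> F = (INF U\<in>?O. pos_var X \<mu> U + neg_var X \<mu> U)"
      unfolding total_var_closed[OF F] by (intro INF_cong) (auto simp: op)
    also have "\<dots> = (INF U\<in>?O. pos_var X \<mu> U) + (INF U\<in>?O. neg_var X \<mu> U)"
    proof (rule INF_ereal_add_directed)
      fix U V assume "U \<in> ?O" "V \<in> ?O"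
      then show "\<exists>W\<in>?O. pos_var X \<mu> U + neg_var X \<mu> V \<ge> pos_var X \<mu> W + neg_var X \<mu> W"
        by (intro bexI[of _ "U \<inter> V"] add_mono monoD[OF pos_var_mono] monoD[OF neg_var_mono]) auto
    qed (simp_all add: pos_var_nonneg[OF H \<mu>] neg_var_nonneg[OF H \<mu>])
    also have "\<dots> = pos_var X \<mu> F + neg_var X \<mu> F"
      unfolding neg_var_def pos_var_closed[OF F] ..
    finally show ?thesis .
  qed
  from A consider "openin X A" | "closedin X A"
    unfolding oc_sets_def by blast
  then show ?thesis
    by cases (rule op cl, assumption)+
qed

theorem theorem41:
  fixes X :: "'a topology" and \<mu> :: "'a set \<Rightarrow> ereal"
  assumes "locally_compact_space X" and "Hausdorff_space X"
    and "signed_topological_measure X \<mu>"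
  shows
    "unique_smallest_on (oc_sets X)
       {\<nu>. deficient_topological_measure X \<nu> \<and> (\<forall>A\<in>oc_sets X. \<mu> A \<le> \<nu> A)}
       (pos_var X \<mu>) \<and>
     unique_smallest_on (oc_sets X)
       {\<nu>. deficient_topological_measure X \<nu> \<and> (\<forall>A\<in>oc_sets X. - \<nu> A \<le> \<mu> A)}
       (neg_var X \<mu>) \<and>
     largest_on (oc_sets X)
       {(\<lambda>A. - \<nu> A) | \<nu>. deficient_topological_measure X \<nu> \<and> (\<forall>A\<in>oc_sets X. - \<nu> A \<le> \<mu> A)}
       (\<lambda>A. - neg_var X \<mu> A) \<and>
     (\<forall>A\<in>oc_sets X. total_var X \<mu> A = pos_var X \<mu> A + neg_var X \<mu> A) \<and>
     (finite_set_function X (pos_var X \<mu>) \<or> finite_set_function X (neg_var X \<mu>) \<longrightarrow>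
       (\<forall>A\<in>oc_sets X. \<mu> A = pos_var X \<mu> A - neg_var X \<mu> A)) \<and>
     (stm_norm X \<mu> < \<infinity> \<longrightarrow>
       finite_set_function X (pos_var X \<mu>) \<or> finite_set_function X (neg_var X \<mu>))"
proof (intro conjI impI)
  note H = assms(2) and \<mu> = assms(3)
  show "unique_smallest_on (oc_sets X)
       {\<nu>. deficient_topological_measure X \<nu> \<and> (\<forall>A\<in>oc_sets X. \<mu> A \<le> \<nu> A)}
       (pos_var X \<mu>)"
    by (rule pos_var_unique_smallest[OF H \<mu>])
  show neg: "unique_smallest_on (oc_sets X)
       {\<nu>. deficient_topological_measure X \<nu> \<and> (\<forall>A\<in>oc_sets X. - \<nu> A \<le> \<mu> A)}
       (neg_var X \<mu>)"
    by (rule neg_var_unique_smallest[OF H \<mu>])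
  show "largest_on (oc_sets X)
       {(\<lambda>A. - \<nu> A) | \<nu>. deficient_topological_measure X \<nu> \<and> (\<forall>A\<in>oc_sets X. - \<nu> A \<le> \<mu> A)}
       (\<lambda>A. - neg_var X \<mu> A)"
    using uminus_largest_on[OF conjunct1[OF neg[unfolded unique_smallest_on_def]]]
    by (simp only: mem_Collect_eq)
  show "\<forall>A\<in>oc_sets X. total_var X \<mu> A = pos_var X \<mu> A + neg_var X \<mu> A"
    by (intro ballI total_var_eq_pos_add_neg[OF H \<mu>])
  show "\<forall>A\<in>oc_sets X. \<mu> A = pos_var X \<mu> A - neg_var X \<mu> A"
    if "finite_set_function X (pos_var X \<mu>) \<or> finite_set_function X (neg_var X \<mu>)"
    by (intro ballI jordan_decomposition[OF H \<mu> _ that])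
  show "finite_set_function X (pos_var X \<mu>) \<or> finite_set_function X (neg_var X \<mu>)"
    if "stm_norm X \<mu> < \<infinity>"
    using finite_pos_var_of_norm[OF that] ..
qed

end
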